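(* For any $\mathcal{BG}$-infinitesimal bialgebra $(A,m,\succ,\prec,\tilde\Delta_{\mathcal{A}ss})$, its primitive part $Prim(A)=\mathrm{Ker}(\tilde\Delta_{\mathcal{A}ss})$ is an $\mathcal{L}$-algebra (for the restrictions of $\succ$ and $\prec$).
   Context: $\mathbb{K}$ is a commutative field. A $\mathcal{BG}$-algebra is a $\mathbb{K}$-vector space $A$ with linear maps $m\,(=\ast),\succ,\prec:A\otimes A\to A$ such that for all $x,y,z\in A$: $(x\ast y)\ast z=x\ast(y\ast z)$, $(x\ast y)\succ z=x\succ(y\succ z)$, $(x\succ y)\ast z=x\succ(y\ast z)$, $(x\prec y)\prec z=x\prec(y\ast z)$, $(x\ast y)\prec z=x\ast(y\prec z)$, $(x\succ y)\prec z=x\succ(y\prec z)$. A $\mathcal{BG}$-infinitesimal bialgebra is a family $(A,m,\succ,\prec,\tilde\Delta_{\mathcal{A}ss})$ where $(A,m,\succ,\prec)$ is a $\mathcal{BG}$-algebra and $\tilde\Delta_{\mathcal{A}ss}:A\to A\otimes A$ is linear with, for all $x,y\in A$: $\tilde\Delta_{\mathcal{A}ss}(xy)=(x\otimes1)\tilde\Delta_{\mathcal{A}ss}(y)+\tilde\Delta_{\mathcal{A}ss}(x)(1\otimes y)+x\otimes y$, $\tilde\Delta_{\mathcal{A}ss}(x\succ y)=(x\otimes1)\succ\tilde\Delta_{\mathcal{A}ss}(y)$, $\tilde\Delta_{\mathcal{A}ss}(x\prec y)=\tilde\Delta_{\mathcal{A}ss}(x)\prec(1\otimes y)$, where $(x\otimes1)(y'\otimes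 y'')=xy'\otimes y''$, $(x'\otimes x'')(1\otimes y)=x'\otimes x''y$, $(x\otimes1)\succ(y'\otimes y'')=(x\succ y')\otimes y''$, $(x'\otimes x'')\prec(1\otimes y)=x'\otimes(x''\prec y)$. An $\mathcal{L}$-algebra is a vector space with two bilinear operations $\succ,\prec$ satisfying $(x\succ y)\prec z=x\succ(y\prec z)$ for all $x,y,z$. *)

theory Defs
  imports Complex_Main "HOL-Library.Poly_Mapping"
begin

section \<open>Free vector spaces\<close>

definition free_scale :: "'k::field \<Rightarrow> ('i \<Rightarrow>\<^sub>0 'k) \<Rightarrow> ('i \<Rightarrow>\<^sub>0 'k)"
  where "free_scale c u = Poly_Mapping.map ((*) c) u"

definition free_extend :: "('k::field \<Rightarrow> 'b::ab_group_add \<Rightarrow> 'b) \<Rightarrow> ('i \<Rightarrow> 'b) \<Rightarrow> ('i \<Rightarrow>\<^sub>0 'k) \<Rightarrow> 'b"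
  where "free_extend s h u = (\<Sum>i\<in>Poly_Mapping.keys u. s (Poly_Mapping.lookup u i) (h i))"

lemma lookup_free_scale [simp]:
  "Poly_Mapping.lookup (free_scale c u) i = c * Poly_Mapping.lookup u i"
  by (simp add: free_scale_def map.rep_eq when_def)

global_interpretation free: vector_space free_scale
  by standard
    (auto intro!: poly_mapping_eqI simp: lookup_add algebra_simps)

lemma free_scale_single [simp]:
  "free_scale c (Poly_Mapping.single i d) = Poly_Mapping.single i (c * d)"
  by (intro poly_mapping_eqI) (auto simp: lookup_single when_def)

context
  fixes s :: "'k::field \<Rightarrow> 'b::ab_group_add \<Rightarrow> 'b"
  assumes s: "vector_space s"
begin

interpretation s: vector_space s by (rule s)

lemma free_extend_superset:
  assumes "finite I" "Poly_Mapping.keys u \<subseteq> I"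
  shows "free_extend s h u = (\<Sum>i\<in>I. s (Poly_Mapping.lookup u i) (h i))"
  unfolding free_extend_def using assms
  by (intro sum.mono_neutral_left) (auto simp: in_keys_iff)

lemma free_extend_linear: "Vector_Spaces.linear free_scale s (free_extend s h)"
proof -
  have "free_extend s h (u + v) = free_extend s h u + free_extend s h v" for u v
  proof -
    let ?I = "Poly_Mapping.keys u \<union> Poly_Mapping.keys v"
    have "Poly_Mapping.keys (u + v) \<subseteq> ?I" by (rule keys_add)
    then show ?thesis
      by (simp add: free_extend_superset[of ?I] lookup_add s.scale_left_distrib sum.distrib)
  qed
  moreover have "free_extend s h (free_scale c u) = s c (free_extend s h u)" for c u
  proof -
    have "Poly_Mapping.keys (free_scale c u) \<subseteq> Poly_Mapping.keys u"
      by (auto simp: in_keys_iff)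
    then show ?thesis
      by (simp add: free_extend_superset[of "Poly_Mapping.keys u"] s.scale_sum_right)
  qed
  ultimately show ?thesis
    by (auto simp: linear_iff_module_hom module_hom_iff s.module_axioms free.module_axioms)
qed

lemma free_extend_single: "free_extend s h (Poly_Mapping.single i c) = s c (h i)"
  by (cases "c = 0") (simp_all add: free_extend_def)

end


section \<open>The tensor square of a vector space\<close>

text \<open>
  For a vector space \<open>A\<close> (a type \<open>'v\<close> with scalar multiplication \<open>scale\<close>), the space
  \<open>A \<otimes> A\<close> is the quotient of the free vector space on \<open>A \<times> A\<close> by the subspace generated by
  the bilinearity relations.  Its elements are the equivalence classes, as sets; its vector space
  structure is given by \<open>tensor_zero\<close>, \<open>tensor_add\<close> and \<open>tensor_scale\<close> on the carrier
  \<open>tensor_space\<close>.  These are not the operations a type class would give on sets.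
\<close>

type_synonym ('k, 'v) tensor = "('v \<times> 'v \<Rightarrow>\<^sub>0 'k) set"

locale tensor_square = vector_space scale
  for scale :: "'a::field \<Rightarrow> 'b::ab_group_add \<Rightarrow> 'b"
begin

definition tensor_relators :: "('b \<times> 'b \<Rightarrow>\<^sub>0 'a) set" where
  "tensor_relators =
     {Poly_Mapping.single (x + x', y) 1 - Poly_Mapping.single (x, y) 1
        - Poly_Mapping.single (x', y) 1 | x x' y. True}
   \<union> {Poly_Mapping.single (x, y + y') 1 - Poly_Mapping.single (x, y) 1
        - Poly_Mapping.single (x, y') 1 | x y y'. True}
   \<union> {Poly_Mapping.single (scale c x, y) 1
        - free_scale c (Poly_Mapping.single (x, y) 1) | c x y. True}
   \<union> {Poly_Mapping.single (x, scale c y) 1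
        - free_scale c (Poly_Mapping.single (x, y) 1) | c x y. True}"

definition tensor_rel :: "(('b \<times> 'b \<Rightarrow>\<^sub>0 'a) \<times> ('b \<times> 'b \<Rightarrow>\<^sub>0 'a)) set"
  where "tensor_rel = {(u, v). u - v \<in> free.span tensor_relators}"

definition tensor_space :: "('a, 'b) tensor set"
  where "tensor_space = UNIV // tensor_rel"

definition tensor_class :: "('b \<times> 'b \<Rightarrow>\<^sub>0 'a) \<Rightarrow> ('a, 'b) tensor"
  where "tensor_class u = tensor_rel `` {u}"

definition pure_tensor :: "'b \<Rightarrow> 'b \<Rightarrow> ('a, 'b) tensor" (infixl \<open>\<otimes>\<close> 72)
  where "x \<otimes> y = tensor_class (Poly_Mapping.single (x, y) 1)"

definition tensor_zero :: "('a, 'b) tensor"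
  where "tensor_zero = tensor_class 0"

definition tensor_add :: "('a, 'b) tensor \<Rightarrow> ('a, 'b) tensor \<Rightarrow> ('a, 'b) tensor"
    (infixl \<open>\<oplus>\<close> 65)
  where "s \<oplus> t = (\<Union>u\<in>s. \<Union>v\<in>t. tensor_class (u + v))"

definition tensor_scale :: "'a \<Rightarrow> ('a, 'b) tensor \<Rightarrow> ('a, 'b) tensor"
  where "tensor_scale c t = (\<Union>u\<in>t. tensor_class (free_scale c u))"

text \<open>
  The map \<open>f \<otimes> g\<close>; meaningful for linear \<open>f\<close> and \<open>g\<close> (see \<open>tensor_map_pure\<close> and
  \<open>tensor_map_class\<close> below).
\<close>

definition tensor_map :: "('b \<Rightarrow> 'b) \<Rightarrow> ('b \<Rightarrow> 'b) \<Rightarrow> ('a, 'b) tensor \<Rightarrow> ('a, 'b) tensor"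
  where "tensor_map f g t =
    (\<Union>u\<in>t. tensor_class
       (free_extend free_scale (\<lambda>(x, y). Poly_Mapping.single (f x, g y) 1) u))"

text \<open>
  For a bilinear operation \<open>\<star>\<close>, \<open>act_left (\<star>) x\<close> is \<open>t \<mapsto> (x \<otimes> 1) \<star> t\<close> and
  \<open>act_right (\<star>) t y\<close> is \<open>t \<star> (1 \<otimes> y)\<close>; no unit in \<open>A\<close> is involved.
\<close>

definition act_left :: "('b \<Rightarrow> 'b \<Rightarrow> 'b) \<Rightarrow> 'b \<Rightarrow> ('a, 'b) tensor \<Rightarrow> ('a, 'b) tensor"
  where "act_left f x t = tensor_map (f x) id t"

definition act_right :: "('b \<Rightarrow> 'b \<Rightarrow> 'b) \<Rightarrow> ('a, 'b) tensor \<Rightarrow> 'b \<Rightarrow> ('a, 'b) tensor"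
  where "act_right f t y = tensor_map id (\<lambda>z. f z y) t"

lemma equiv_tensor_rel: "equiv UNIV tensor_rel"
proof (rule equivI)
  show "refl tensor_rel"
    by (auto simp: refl_on_def tensor_rel_def free.span_zero)
  show "sym tensor_rel"
  proof (rule symI)
    fix u v assume "(u, v) \<in> tensor_rel"
    then have "- (u - v) \<in> free.span tensor_relators"
      unfolding tensor_rel_def by (blast intro: free.span_neg)
    then show "(v, u) \<in> tensor_rel" by (simp add: tensor_rel_def)
  qed
  show "trans tensor_rel"
  proof (rule transI)
    fix u v w assume "(u, v) \<in> tensor_rel" "(v, w) \<in> tensor_rel"
    then have "(u - v) + (v - w) \<in> free.span tensor_relators"
      unfolding tensor_rel_def by (blast intro: free.span_add)
    then show "(u, w) \<in> tensor_rel" by (simp add: tensor_rel_def)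
  qed
qed auto

lemma tensor_class_eq_iff:
  "tensor_class u = tensor_class v \<longleftrightarrow> u - v \<in> free.span tensor_relators"
  unfolding tensor_class_def using eq_equiv_class_iff[OF equiv_tensor_rel, of u v]
  by (simp add: tensor_rel_def)

lemma mem_tensor_class: "v \<in> tensor_class u \<longleftrightarrow> tensor_class v = tensor_class u"
proof -
  have "v \<in> tensor_class u \<longleftrightarrow> tensor_class u = tensor_class v"
    by (simp add: tensor_class_eq_iff) (simp add: tensor_class_def tensor_rel_def)
  then show ?thesis by metis
qed

lemma tensor_space_eq: "tensor_space = range tensor_class"
  by (auto simp: tensor_space_def tensor_class_def quotient_def)

lemma UN_tensor_class:
  assumes "\<And>v. tensor_class v = tensor_class u \<Longrightarrow> F v = F u"
  shows "(\<Union>v\<in>tensor_class u. F v) = F u"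
proof -
  have "u \<in> tensor_class u" by (simp add: mem_tensor_class)
  moreover have "F v = F u" if "v \<in> tensor_class u" for v
    using that by (intro assms) (simp only: mem_tensor_class)
  ultimately show ?thesis by blast
qed

lemma tensor_add_class: "tensor_class u \<oplus> tensor_class v = tensor_class (u + v)"
proof -
  have *: "tensor_class (u' + v') = tensor_class (u'' + v'')"
    if "tensor_class u' = tensor_class u''" "tensor_class v' = tensor_class v''" for u' v' u'' v''
  proof -
    have "(u' - u'') + (v' - v'') \<in> free.span tensor_relators"
      using that unfolding tensor_class_eq_iff by (rule free.span_add)
    then show ?thesis unfolding tensor_class_eq_iff by (simp only: add_diff_add)
  qed
  have inner: "(\<Union>v'\<in>tensor_class v. tensor_class (u' + v')) = tensor_class (u' + v)" for u'
    by (rule UN_tensor_class) (rule *[OF refl])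
  show ?thesis
    unfolding tensor_add_def inner by (rule UN_tensor_class) (erule *[OF _ refl])
qed

lemma tensor_scale_class: "tensor_scale c (tensor_class u) = tensor_class (free_scale c u)"
  unfolding tensor_scale_def
proof (rule UN_tensor_class)
  fix v assume "tensor_class v = tensor_class u"
  then have "free_scale c (v - u) \<in> free.span tensor_relators"
    unfolding tensor_class_eq_iff by (rule free.span_scale)
  then show "tensor_class (free_scale c v) = tensor_class (free_scale c u)"
    unfolding tensor_class_eq_iff by (simp only: free.scale_right_diff_distrib)
qed

lemma pure_tensor_bilinear:
  "(x + x') \<otimes> y = x \<otimes> y \<oplus> x' \<otimes> y"
  "x \<otimes> (y + y') = x \<otimes> y \<oplus> x \<otimes> y'"
  "scale c x \<otimes> y = tensor_scale c (x \<otimes> y)"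
  "x \<otimes> scale c y = tensor_scale c (x \<otimes> y)"
proof -
  show "(x + x') \<otimes> y = x \<otimes> y \<oplus> x' \<otimes> y"
    unfolding pure_tensor_def tensor_add_class tensor_class_eq_iff diff_diff_eq[symmetric]
    by (rule free.span_base, unfold tensor_relators_def, rule UnI1, rule UnI1, rule UnI1,
        rule CollectI, intro exI conjI, rule refl) simp
  show "x \<otimes> (y + y') = x \<otimes> y \<oplus> x \<otimes> y'"
    unfolding pure_tensor_def tensor_add_class tensor_class_eq_iff diff_diff_eq[symmetric]
    by (rule free.span_base, unfold tensor_relators_def, rule UnI1, rule UnI1, rule UnI2,
        rule CollectI, intro exI conjI, rule refl) simp
  show "scale c x \<otimes> y = tensor_scale c (x \<otimes> y)"
    unfolding pure_tensor_def tensor_scale_class tensor_class_eq_iff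
    by (rule free.span_base, unfold tensor_relators_def, rule UnI1, rule UnI2,
        rule CollectI, intro exI conjI, rule refl) simp
  show "x \<otimes> scale c y = tensor_scale c (x \<otimes> y)"
    unfolding pure_tensor_def tensor_scale_class tensor_class_eq_iff
    by (rule free.span_base, unfold tensor_relators_def, rule UnI2,
        rule CollectI, intro exI conjI, rule refl) simp
qed

text \<open>Bilinear maps on \<open>A \<times> A\<close> factor through the tensor square.\<close>

lemma free_extend_bilinear_cong:
  fixes s :: "'a \<Rightarrow> 'c::ab_group_add \<Rightarrow> 'c" and h :: "'b \<Rightarrow> 'b \<Rightarrow> 'c"
  assumes "\<And>x. Vector_Spaces.linear scale s (h x)"
      "\<And>y. Vector_Spaces.linear scale s (\<lambda>x. h x y)"
    and "tensor_class u = tensor_class v"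
  shows "free_extend s (\<lambda>(x, y). h x y) u = free_extend s (\<lambda>(x, y). h x y) v"
proof -
  interpret s: vector_space s
    using assms(1) by (simp add: Vector_Spaces.linear_def)
  let ?E = "free_extend s (\<lambda>(x, y). h x y)"
  interpret E: Vector_Spaces.linear free_scale s ?E
    by (rule free_extend_linear) unfold_locales
  have r: "h x (y + y') = h x y + h x y'" "h x (scale c y) = s c (h x y)" for x y y' c
    using assms(1)[of x] unfolding linear_iff_module_hom module_hom_iff by auto
  have l: "h (x + x') y = h x y + h x' y" "h (scale c x) y = s c (h x y)" for x x' y c
    using assms(2)[of y] unfolding linear_iff_module_hom module_hom_iff by auto
  have "u - v \<in> free.span tensor_relators"
    using assms(3) by (simp add: tensor_class_eq_iff)
  then have "?E (u - v) = 0"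
  proof (induction rule: free.span_induct)
    case base
    show ?case by (auto simp: free.subspace_def E.zero E.add E.scale)
  next
    case (step w)
    then show ?case
      by (auto simp: tensor_relators_def E.diff r l free_extend_single[OF s.vector_space_axioms])
  qed
  then show ?thesis by (simp add: E.diff)
qed

lemma tensor_map_class:
  assumes "Vector_Spaces.linear scale scale f" "Vector_Spaces.linear scale scale g"
  shows "tensor_map f g (tensor_class u) =
    tensor_class (free_extend free_scale (\<lambda>(x, y). Poly_Mapping.single (f x, g y) 1) u)"
  unfolding tensor_map_def
proof (rule UN_tensor_class)
  fix v assume v: "tensor_class v = tensor_class u"
  let ?E = "free_extend free_scale (\<lambda>(x, y). Poly_Mapping.single (f x, g y) (1::'a))"
  interpret E: Vector_Spaces.linear free_scale free_scale ?E
    by (rule free_extend_linear) unfold_locales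
  have f: "f (x + x') = f x + f x'" "f (scale c x) = scale c (f x)" for x x' c
    using assms(1) unfolding linear_iff_module_hom module_hom_iff by auto
  have g: "g (x + x') = g x + g x'" "g (scale c x) = scale c (g x)" for x x' c
    using assms(2) unfolding linear_iff_module_hom module_hom_iff by auto
  have "v - u \<in> free.span tensor_relators"
    using v by (simp add: tensor_class_eq_iff)
  then have "?E (v - u) \<in> free.span tensor_relators"
  proof (induction rule: free.span_induct)
    case base
    show ?case
      by (auto simp: free.subspace_def E.zero E.add E.scale free.span_zero
          intro: free.span_add free.span_scale)
  next
    case (step w)
    have E_single: "?E (Poly_Mapping.single (x, y) c) = Poly_Mapping.single (f x, g y) c" for x y c
      by (simp add: free_extend_single[OF free.vector_space_axioms])
    from step consider
        x x' y where "w = Poly_Mapping.single (x + x', y) 1 - Poly_Mapping.single (x, y) 1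
          - Poly_Mapping.single (x', y) 1"
      | x y y' where "w = Poly_Mapping.single (x, y + y') 1 - Poly_Mapping.single (x, y) 1
          - Poly_Mapping.single (x, y') 1"
      | c x y where "w = Poly_Mapping.single (scale c x, y) 1
          - free_scale c (Poly_Mapping.single (x, y) 1)"
      | c x y where "w = Poly_Mapping.single (x, scale c y) 1
          - free_scale c (Poly_Mapping.single (x, y) 1)"
      unfolding tensor_relators_def by blast
    then show ?case
    proof cases
      case 1
      then have "?E w = Poly_Mapping.single (f x + f x', g y) 1 - Poly_Mapping.single (f x, g y) 1
          - Poly_Mapping.single (f x', g y) 1"
        by (simp only: E.diff E_single f)
      then show ?thesis
        using pure_tensor_bilinear(1)[of "f x" "f x'" "g y"]
        unfolding pure_tensor_def tensor_add_class tensor_class_eq_iff diff_diff_eq[symmetric]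
        by (simp only:)
    next
      case 2
      then have "?E w = Poly_Mapping.single (f x, g y + g y') 1 - Poly_Mapping.single (f x, g y) 1
          - Poly_Mapping.single (f x, g y') 1"
        by (simp only: E.diff E_single g)
      then show ?thesis
        using pure_tensor_bilinear(2)[of "f x" "g y" "g y'"]
        unfolding pure_tensor_def tensor_add_class tensor_class_eq_iff diff_diff_eq[symmetric]
        by (simp only:)
    next
      case 3
      then have "?E w = Poly_Mapping.single (scale c (f x), g y) 1
          - free_scale c (Poly_Mapping.single (f x, g y) 1)"
        by (simp only: E.diff E.scale E_single f)
      then show ?thesis
        using pure_tensor_bilinear(3)[of c "f x" "g y"]
        unfolding pure_tensor_def tensor_scale_class tensor_class_eq_iff by (simp only:)
    next
      case 4
      then have "?E w = Poly_Mapping.single (f x, scale c (g y)) 1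
          - free_scale c (Poly_Mapping.single (f x, g y) 1)"
        by (simp only: E.diff E.scale E_single g)
      then show ?thesis
        using pure_tensor_bilinear(4)[of "f x" c "g y"]
        unfolding pure_tensor_def tensor_scale_class tensor_class_eq_iff by (simp only:)
    qed
  qed
  then show "tensor_class (?E v) = tensor_class (?E u)"
    by (simp add: tensor_class_eq_iff E.diff)
qed

lemma tensor_map_pure:
  assumes "Vector_Spaces.linear scale scale f" "Vector_Spaces.linear scale scale g"
  shows "tensor_map f g (x \<otimes> y) = f x \<otimes> g y"
  by (simp add: pure_tensor_def tensor_map_class assms free_extend_single[OF free.vector_space_axioms])

end


section \<open>Algebras and bialgebras\<close>

context tensor_square
begin

definition bilinear_on :: "'b set \<Rightarrow> ('b \<Rightarrow> 'b \<Rightarrow> 'b) \<Rightarrow> bool" where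
  "bilinear_on S f \<longleftrightarrow>
     (\<forall>x\<in>S. \<forall>y\<in>S. f x y \<in> S) \<and>
     (\<forall>x\<in>S. \<forall>x'\<in>S. \<forall>y\<in>S. f (x + x') y = f x y + f x' y) \<and>
     (\<forall>x\<in>S. \<forall>y\<in>S. \<forall>y'\<in>S. f x (y + y') = f x y + f x y') \<and>
     (\<forall>c. \<forall>x\<in>S. \<forall>y\<in>S. f (scale c x) y = scale c (f x y)) \<and>
     (\<forall>c. \<forall>x\<in>S. \<forall>y\<in>S. f x (scale c y) = scale c (f x y))"

lemma bilinear_on_UNIV:
  "bilinear_on UNIV f \<longleftrightarrow>
     (\<forall>x. Vector_Spaces.linear scale scale (f x)) \<and> (\<forall>y. Vector_Spaces.linear scale scale (\<lambda>x. f x y))"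
  unfolding bilinear_on_def linear_iff_module_hom module_hom_iff using module_axioms by auto

lemma act_left_pure: "bilinear_on UNIV f \<Longrightarrow> act_left f x (y \<otimes> z) = f x y \<otimes> z"
  by (simp add: act_left_def tensor_map_pure bilinear_on_UNIV linear_id)

lemma act_right_pure: "bilinear_on UNIV f \<Longrightarrow> act_right f (x \<otimes> z) y = x \<otimes> f z y"
  by (simp add: act_right_def tensor_map_pure bilinear_on_UNIV linear_id)

end

text \<open>An \<open>\<L>\<close>-algebra whose underlying vector space is the subspace \<open>S\<close> of an ambient one.\<close>

locale L_algebra = tensor_square scale
  for scale :: "'k::field \<Rightarrow> 'v::ab_group_add \<Rightarrow> 'v" +
  fixes S :: "'v set"
    and succ :: "'v \<Rightarrow> 'v \<Rightarrow> 'v" (infixl \<open>\<succ>\<close> 70)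
    and prec :: "'v \<Rightarrow> 'v \<Rightarrow> 'v" (infixl \<open>\<prec>\<close> 70)
  assumes subspace_carrier: "subspace S"
    and bilinear_succ: "bilinear_on S (\<succ>)"
    and bilinear_prec: "bilinear_on S (\<prec>)"
    and succ_prec: "\<lbrakk>x \<in> S; y \<in> S; z \<in> S\<rbrakk> \<Longrightarrow> (x \<succ> y) \<prec> z = x \<succ> (y \<prec> z)"

locale BG_algebra = tensor_square scale
  for scale :: "'k::field \<Rightarrow> 'v::ab_group_add \<Rightarrow> 'v" +
  fixes mult :: "'v \<Rightarrow> 'v \<Rightarrow> 'v" (infixl \<open>\<^bold>*\<close> 70)
    and succ :: "'v \<Rightarrow> 'v \<Rightarrow> 'v" (infixl \<open>\<succ>\<close> 70)
    and prec :: "'v \<Rightarrow> 'v \<Rightarrow> 'v" (infixl \<open>\<prec>\<close> 70)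
  assumes bilinear_mult: "bilinear_on UNIV (\<^bold>*)"
    and bilinear_succ: "bilinear_on UNIV (\<succ>)"
    and bilinear_prec: "bilinear_on UNIV (\<prec>)"
    and mult_assoc: "(x \<^bold>* y) \<^bold>* z = x \<^bold>* (y \<^bold>* z)"
    and mult_succ: "(x \<^bold>* y) \<succ> z = x \<succ> (y \<succ> z)"
    and succ_mult: "(x \<succ> y) \<^bold>* z = x \<succ> (y \<^bold>* z)"
    and prec_prec: "(x \<prec> y) \<prec> z = x \<prec> (y \<^bold>* z)"
    and mult_prec: "(x \<^bold>* y) \<prec> z = x \<^bold>* (y \<prec> z)"
    and succ_prec: "(x \<succ> y) \<prec> z = x \<succ> (y \<prec> z)"

locale BG_infinitesimal_bialgebra = BG_algebra scale mult succ prec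
  for scale :: "'k::field \<Rightarrow> 'v::ab_group_add \<Rightarrow> 'v"
    and mult :: "'v \<Rightarrow> 'v \<Rightarrow> 'v" (infixl \<open>\<^bold>*\<close> 70)
    and succ :: "'v \<Rightarrow> 'v \<Rightarrow> 'v" (infixl \<open>\<succ>\<close> 70)
    and prec :: "'v \<Rightarrow> 'v \<Rightarrow> 'v" (infixl \<open>\<prec>\<close> 70) +
  fixes \<Delta> :: "'v \<Rightarrow> ('k, 'v) tensor"
  assumes coproduct_in: "\<Delta> x \<in> tensor_space"
    and coproduct_add: "\<Delta> (x + y) = \<Delta> x \<oplus> \<Delta> y"
    and coproduct_scale: "\<Delta> (scale c x) = tensor_scale c (\<Delta> x)"
    and coproduct_mult:
      "\<Delta> (x \<^bold>* y) = act_left (\<^bold>*) x (\<Delta> y) \<oplus> act_right (\<^bold>*) (\<Delta> x) y \<oplus> x \<otimes> y"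
    and coproduct_succ: "\<Delta> (x \<succ> y) = act_left (\<succ>) x (\<Delta> y)"
    and coproduct_prec: "\<Delta> (x \<prec> y) = act_right (\<prec>) (\<Delta> x) y"

definition (in tensor_square) Prim :: "('b \<Rightarrow> ('a, 'b) tensor) \<Rightarrow> 'b set"
  where "Prim \<Delta> = {x. \<Delta> x = tensor_zero}"

end

theory Submission
  imports Defs
begin

text \<open>
  The identity \<open>(x \<succ> y) \<prec> z = x \<succ> (y \<prec> z)\<close> and bilinearity hold on all of \<open>A\<close>, so they restrict to
  any subspace closed under \<open>\<succ>\<close> and \<open>\<prec>\<close>.  The kernel of the linear map \<open>\<Delta>\<close> is a subspace.
  It is closed under the two operations because \<open>\<Delta> (x \<succ> y)\<close> is the image of \<open>\<Delta> y\<close>, and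
  \<open>\<Delta> (x \<prec> y)\<close> the image of \<open>\<Delta> x\<close>, under a linear endomorphism of \<open>A \<otimes> A\<close>, which sends \<open>0\<close> to
  \<open>0\<close>.  In fact \<open>Prim(A)\<close> is a left ideal for \<open>\<succ>\<close> and a right ideal for \<open>\<prec>\<close>.
\<close>

context tensor_square
begin

lemma tensor_add_zero: "tensor_zero \<oplus> tensor_zero = tensor_zero"
  by (simp add: tensor_zero_def tensor_add_class)

lemma tensor_scale_zero: "tensor_scale c tensor_zero = tensor_zero"
  by (simp add: tensor_zero_def tensor_scale_class)

text \<open>
  The carrier hypothesis matters: applied to the empty set, which is not a tensor,
  \<open>tensor_scale\<close> returns the empty set.
\<close>

lemma tensor_scale_by_zero: "t \<in> tensor_space \<Longrightarrow> tensor_scale 0 t = tensor_zero"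
  by (auto simp: tensor_space_eq tensor_scale_class tensor_zero_def)

lemma tensor_map_zero:
  assumes "Vector_Spaces.linear scale scale f" "Vector_Spaces.linear scale scale g"
  shows "tensor_map f g tensor_zero = tensor_zero"
  by (simp add: tensor_zero_def tensor_map_class[OF assms] free_extend_def)

lemma act_left_zero: "bilinear_on UNIV f \<Longrightarrow> act_left f x tensor_zero = tensor_zero"
  by (simp add: act_left_def tensor_map_zero bilinear_on_UNIV linear_id)

lemma act_right_zero: "bilinear_on UNIV f \<Longrightarrow> act_right f tensor_zero y = tensor_zero"
  by (simp add: act_right_def tensor_map_zero bilinear_on_UNIV linear_id)

lemma bilinear_on_subset:
  assumes "bilinear_on T f" "S \<subseteq> T" "\<And>x y. \<lbrakk>x \<in> S; y \<in> S\<rbrakk> \<Longrightarrow> f x y \<in> S"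
  shows "bilinear_on S f"
  using assms unfolding bilinear_on_def by (simp add: subset_iff)

end

context BG_infinitesimal_bialgebra
begin

lemma coproduct_zero: "\<Delta> 0 = tensor_zero"
  using coproduct_scale[of 0 0] by (simp add: tensor_scale_by_zero coproduct_in)

lemma subspace_Prim: "subspace (Prim \<Delta>)"
  by (simp add: subspace_def Prim_def coproduct_zero coproduct_add coproduct_scale
      tensor_add_zero tensor_scale_zero)

lemma Prim_succ_closed: "y \<in> Prim \<Delta> \<Longrightarrow> x \<succ> y \<in> Prim \<Delta>"
  by (simp add: Prim_def coproduct_succ act_left_zero bilinear_succ)

lemma Prim_prec_closed: "x \<in> Prim \<Delta> \<Longrightarrow> x \<prec> y \<in> Prim \<Delta>"
  by (simp add: Prim_def coproduct_prec act_right_zero bilinear_prec)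

end

theorem proposition58:
  fixes scale :: "'k::field \<Rightarrow> 'v::ab_group_add \<Rightarrow> 'v"
    and mult succ prec :: "'v \<Rightarrow> 'v \<Rightarrow> 'v"
    and \<Delta> :: "'v \<Rightarrow> ('k, 'v) tensor"
  assumes "BG_infinitesimal_bialgebra scale mult succ prec \<Delta>"
  shows "L_algebra scale (tensor_square.Prim scale \<Delta>) succ prec"
proof -
  interpret BG_infinitesimal_bialgebra scale mult succ prec \<Delta> by (rule assms)
  show ?thesis
  proof
    show "subspace (Prim \<Delta>)" by (rule subspace_Prim)
    show "bilinear_on (Prim \<Delta>) succ"
      by (rule bilinear_on_subset[OF bilinear_succ subset_UNIV Prim_succ_closed])
    show "bilinear_on (Prim \<Delta>) prec"
      by (rule bilinear_on_subset[OF bilinear_prec subset_UNIV Prim_prec_closed])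
    show "prec (succ x y) z = succ x (prec y z)" for x y z by (rule succ_prec)
  qed
qed

end
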